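(* We have $$\sum_{n=0}^\infty\frac{9n+2}{(-216)^n}\sum_{k=0}^n\binom{2k}k\binom{3k}k\binom{2(n-k)}{n-k}\binom{3(n-k)}{n-k}=\frac 8{\sqrt3\,\pi}.$$ Also, $${}_2F_1\!\left(\tfrac13,\tfrac23;1;-\tfrac18\right)^2-\frac14\,{}_2F_1\!\left(\tfrac13,\tfrac23;1;-\tfrac18\right)\,{}_2F_1\!\left(\tfrac43,\tfrac53;2;-\tfrac18\right)=\frac 4{\sqrt3\,\pi}.$$
   Context: Here ${}_2F_1(a,b;c;z):=1+\sum_{n=1}^\infty\left(\prod_{k=0}^{n-1}\frac{(a+k)(b+k)}{(k+1)(c+k)}\right)z^n$ is the Gauss hypergeometric series. *)

theory Defs
  imports "HOL-Analysis.Analysis"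
begin

text \<open>The Gauss hypergeometric series. The summand with index \<open>n\<close> below is the term of degree
  \<open>n + 1\<close>, since \<open>suminf\<close> starts at \<open>0\<close> while the series after the constant term starts at \<open>1\<close>.
  The value is meaningful for \<open>c\<close> not a non-positive integer and \<open>norm z < 1\<close>.\<close>

definition gauss_2F1 :: "'a \<Rightarrow> 'a \<Rightarrow> 'a \<Rightarrow> 'a \<Rightarrow> 'a::{real_normed_field,banach}"
  where "gauss_2F1 a b c z =
    1 + (\<Sum>n. (\<Prod>k=0..n. ((a + of_nat k) * (b + of_nat k)) / ((of_nat k + 1) * (c + of_nat k)))
               * z ^ (n + 1))"

end

theory Submission
  imports Defs "HOL-Real_Asymp.Real_Asymp"
begin

text \<open>Put \<open>F = 2F1(1/3, 2/3; 1; _)\<close>, \<open>H = 2F1(1/3, 1/3; 1; _)\<close> and \<open>t = (1 + 2x)/(1 - x)\<close>. A cubic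
  transformation gives \<open>(1 - x) F(x\<^sup>3) = H(1 - t\<^sup>3)\<close> for \<open>-1/2 < x \<le> 0\<close>. The point \<open>-1/8\<close> is \<open>x\<^sup>3\<close> at
  \<open>x = -1/2\<close>, where \<open>t = 0\<close>, so as \<open>x\<close> tends to \<open>-1/2\<close> the value and the derivative of the left-hand side are
  expressed by hypergeometric series at \<open>1\<close> (the derivative after an Euler transformation), which Gauss's
  summation theorem evaluates. In the product of the two the Gamma values combine to
  \<open>1 / (\<Gamma>(1/3) \<Gamma>(2/3)) = sqrt 3 / (2 \<pi>)\<close>, which is the second identity. The first one
  follows from the second, because \<open>(2k choose k) (3k choose k)\<close> is \<open>27\<^sup>k\<close> times the \<open>k\<close>-th coefficient of
  \<open>F\<close> and the series is a linear combination of the Cauchy products \<open>F\<^sup>2\<close> and \<open>F F'\<close> at \<open>-1/8\<close>.\<close>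

subsection \<open>Coefficients and the hypergeometric equation\<close>

text \<open>The coefficient of \<open>z ^ n\<close>, degree 0 included: the empty product absorbs
  the constant term that \<open>gauss_2F1\<close> writes separately.\<close>

definition hyp_coeff :: "real \<Rightarrow> real \<Rightarrow> real \<Rightarrow> nat \<Rightarrow> real"
  where "hyp_coeff a b c n = (\<Prod>k<n. ((a + real k) * (b + real k)) / ((real k + 1) * (c + real k)))"

lemma hyp_coeff_0 [simp]: "hyp_coeff a b c 0 = 1"
  by (simp add: hyp_coeff_def)

lemma hyp_coeff_Suc:
  "hyp_coeff a b c (Suc n) =
     hyp_coeff a b c n * (((a + real n) * (b + real n)) / ((real n + 1) * (c + real n)))"
  by (simp add: hyp_coeff_def)

lemma hyp_coeff_rec:
  assumes "c > 0"
  shows "(real n + 1) * (c + real n) * hyp_coeff a b c (Suc n) =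
           (a + real n) * (b + real n) * hyp_coeff a b c n"
proof -
  have "real n + 1 \<noteq> 0" "c + real n \<noteq> 0" using assms by auto
  thus ?thesis by (simp add: hyp_coeff_Suc divide_simps)
qed

text \<open>Coefficient form of the rule that the derivative of \<open>2F1(a, b; c)\<close> is
  \<open>a b / c\<close> times \<open>2F1(a + 1, b + 1; c + 1)\<close>, with denominators
  cleared.\<close>

lemma hyp_coeff_shift:
  assumes "c > 0"
  shows "(real n + 1) * c * hyp_coeff a b c (Suc n) = a * b * hyp_coeff (a + 1) (b + 1) (c + 1) n"
proof (induction n)
  case 0
  show ?case using assms by (simp add: hyp_coeff_Suc)
next
  case (Suc n)
  have pos: "real n + 1 > 0" "real n + 2 > 0" "c + real n + 1 > 0" using assms by auto
  have "(real n + 1) * ((real n + 2) * (c + real n + 1) * hyp_coeff a b c (Suc (Suc n)) * c) =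
        (real n + 1) * c * hyp_coeff a b c (Suc n) * ((a + real n + 1) * (b + real n + 1))"
    using hyp_coeff_rec[OF assms, of "Suc n" a b] by (simp add: algebra_simps)
  also have "\<dots> = a * b * ((a + 1 + real n) * (b + 1 + real n) * hyp_coeff (a + 1) (b + 1) (c + 1) n)"
    by (simp only: Suc.IH) (simp add: algebra_simps)
  also have "\<dots> = a * b * ((real n + 1) * (c + 1 + real n) * hyp_coeff (a + 1) (b + 1) (c + 1) (Suc n))"
    using assms by (subst hyp_coeff_rec) auto
  finally have "((real n + 1) * (c + real n + 1)) * ((real n + 2) * c * hyp_coeff a b c (Suc (Suc n))) =
      ((real n + 1) * (c + real n + 1)) * (a * b * hyp_coeff (a + 1) (b + 1) (c + 1) (Suc n))"
    by (simp add: algebra_simps)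
  thus ?case using pos by (simp add: add.commute[of 2])
qed

lemma hyp_coeff_nonneg: "a > 0 \<Longrightarrow> b > 0 \<Longrightarrow> c > 0 \<Longrightarrow> hyp_coeff a b c n \<ge> 0"
  unfolding hyp_coeff_def by (intro prod_nonneg) auto

section \<open>Convergence, differentiation and the differential equation inside the unit
  interval\<close>

lemma summable_hyp_coeff:
  assumes "c > 0" "\<bar>z\<bar> < 1"
  shows "summable (\<lambda>n. hyp_coeff a b c n * z ^ n)"
proof -
  define r where "r = (\<bar>z\<bar> + 1) / 2"
  have r: "\<bar>z\<bar> < r" "r < 1" using assms by (auto simp: r_def)
  \<comment> \<open>The ratio of consecutive terms tends to \<open>\<bar>z\<bar>\<close> in absolute
    value, so it is eventually below the midpoint \<open>r\<close> of \<open>\<bar>z\<bar>\<close>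
    and 1.\<close>
  have "(\<lambda>n. \<bar>z\<bar> * \<bar>((a + real n) * (b + real n)) / ((real n + 1) * (c + real n))\<bar>) \<longlonglongrightarrow> \<bar>z\<bar> * \<bar>1\<bar>"
    by (intro tendsto_intros) real_asymp
  hence "eventually (\<lambda>n. \<bar>z\<bar> * \<bar>((a + real n) * (b + real n)) / ((real n + 1) * (c + real n))\<bar> < r) sequentially"
    by (rule order_tendstoD) (use r in simp)
  then obtain N where N:
    "\<bar>z\<bar> * \<bar>((a + real n) * (b + real n)) / ((real n + 1) * (c + real n))\<bar> < r" if "n \<ge> N" for n
    by (auto simp: eventually_sequentially)
  show ?thesis
  proof (rule summable_ratio_test[OF r(2)])
    fix n assume "n \<ge> N"
    from mult_right_mono[OF less_imp_le[OF N[OF this]], of "\<bar>hyp_coeff a b c n * z ^ n\<bar>"]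
    show "norm (hyp_coeff a b c (Suc n) * z ^ Suc n) \<le> r * norm (hyp_coeff a b c n * z ^ n)"
      by (simp add: hyp_coeff_Suc abs_mult mult_ac)
  qed
qed

text \<open>Summability is assumed rather than \<open>\<bar>z\<bar> < 1\<close> so that the point
  \<open>z = 1\<close> is covered as well.\<close>

lemma gauss_2F1_eq_suminf:
  assumes "summable (\<lambda>n. hyp_coeff a b c n * z ^ n)"
  shows "gauss_2F1 a b c z = (\<Sum>n. hyp_coeff a b c n * z ^ n)"
proof -
  have "gauss_2F1 a b c z = 1 + (\<Sum>n. hyp_coeff a b c (Suc n) * z ^ Suc n)"
    unfolding gauss_2F1_def hyp_coeff_def lessThan_Suc_atMost atLeast0AtMost by simp
  also have "\<dots> = (\<Sum>n. hyp_coeff a b c n * z ^ n)"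
    using suminf_split_head[OF assms] by simp
  finally show ?thesis .
qed

lemma gauss_2F1_sums:
  assumes "c > 0" "\<bar>z\<bar> < 1"
  shows "(\<lambda>n. hyp_coeff a b c n * z ^ n) sums gauss_2F1 a b c z"
  using summable_hyp_coeff[OF assms] by (simp add: gauss_2F1_eq_suminf summable_sums)

lemma gauss_2F1_0 [simp]: "gauss_2F1 a b c (0::real) = 1"
  by (simp add: gauss_2F1_def)

lemma gauss_2F1_pos:
  assumes "a > 0" "b > 0" "c > 0" "0 \<le> z" "z < (1::real)"
  shows "gauss_2F1 a b c z > 0"
  unfolding gauss_2F1_def using assms
  by (intro add_pos_nonneg suminf_nonneg)
     (use summable_hyp_coeff[of c z a b, THEN summable_ignore_initial_segment, of 1]
      in \<open>auto intro!: mult_nonneg_nonneg prod_nonneg simp: hyp_coeff_def atLeast0AtMost lessThan_Suc_atMost\<close>)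

lemma has_field_derivative_gauss_2F1:
  fixes z :: real
  assumes "c > 0" "\<bar>z\<bar> < 1"
  shows "(gauss_2F1 a b c has_field_derivative a * b / c * gauss_2F1 (a + 1) (b + 1) (c + 1) z) (at z)"
proof -
  \<comment> \<open>Termwise differentiation at \<open>z\<close> rests on convergence at a point
    \<open>K\<close> of larger modulus.\<close>
  obtain K where K: "\<bar>z\<bar> < K" "K < 1" using assms(2) dense by blast
  have "((\<lambda>z. \<Sum>n. hyp_coeff a b c n * z ^ n) has_field_derivative
          (\<Sum>n. diffs (hyp_coeff a b c) n * z ^ n)) (at z)"
    by (rule termdiffs_strong[of _ K]) (use K assms in \<open>auto intro!: summable_hyp_coeff\<close>)
  also have "diffs (hyp_coeff a b c) = (\<lambda>n. a * b / c * hyp_coeff (a + 1) (b + 1) (c + 1) n)"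
    using hyp_coeff_shift[OF assms(1)] assms(1) by (auto simp: diffs_def fun_eq_iff field_simps)
  also have "(\<Sum>n. a * b / c * hyp_coeff (a + 1) (b + 1) (c + 1) n * z ^ n) =
               a * b / c * gauss_2F1 (a + 1) (b + 1) (c + 1) z"
    using sums_mult[OF gauss_2F1_sums[of "c + 1" z "a + 1" "b + 1"], of "a * b / c"] assms
    by (simp add: sums_iff mult_ac)
  finally show ?thesis
  proof (rule has_field_derivative_transform_within_open)
    show "open {-1<..<1::real}" by simp
  qed (use assms in \<open>auto intro!: sums_unique[symmetric] gauss_2F1_sums\<close>)
qed

lemmas DERIV_gauss_2F1 [derivative_intros] = has_field_derivative_gauss_2F1[THEN DERIV_chain2]

lemma continuous_on_gauss_2F1 [continuous_intros]:
  fixes f :: "'a :: topological_space \<Rightarrow> real"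
  assumes "continuous_on A f" "c > 0" "\<And>x. x \<in> A \<Longrightarrow> \<bar>f x\<bar> < 1"
  shows "continuous_on A (\<lambda>x. gauss_2F1 a b c (f x))"
proof -
  have "continuous_on {-1<..<1} (gauss_2F1 a b c)"
    by (intro continuous_at_imp_continuous_on ballI DERIV_isCont[OF has_field_derivative_gauss_2F1])
       (use assms(2) in auto)
  thus ?thesis
    by (rule continuous_on_compose2) (use assms in force)+
qed

text \<open>The series of \<open>z\<close> times the derivative. Its term at \<open>n = 0\<close>
  vanishes, so the derivative series is shifted up by one degree.\<close>

lemma sums_of_nat_times_hyp_coeff:
  fixes z :: real
  assumes "c > 0" "\<bar>z\<bar> < 1"
  shows "(\<lambda>n. real n * hyp_coeff a b c n * z ^ n) sums
           (a * b / c * gauss_2F1 (a + 1) (b + 1) (c + 1) z * z)"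
proof -
  have shift: "real (Suc n) * hyp_coeff a b c (Suc n) = a * b / c * hyp_coeff (a + 1) (b + 1) (c + 1) n" for n
    using hyp_coeff_shift[of c n a b] assms by (simp add: field_simps)
  have "(\<lambda>n. a * b / c * (hyp_coeff (a + 1) (b + 1) (c + 1) n * z ^ n) * z) sums
          (a * b / c * gauss_2F1 (a + 1) (b + 1) (c + 1) z * z)"
    using assms by (intro sums_mult sums_mult2 gauss_2F1_sums) auto
  also have "(\<lambda>n. a * b / c * (hyp_coeff (a + 1) (b + 1) (c + 1) n * z ^ n) * z) =
               (\<lambda>n. real (Suc n) * hyp_coeff a b c (Suc n) * z ^ Suc n)"
    unfolding shift by (simp add: mult_ac)
  finally show ?thesis
    by (subst (asm) sums_Suc_iff) simp
qed

text \<open>The hypergeometric differential equation, with the first derivative replaced by the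
  contiguous function \<open>gauss_2F1 (a + 1) (b + 1) (c + 1)\<close> to which it is proportional.\<close>

lemma gauss_2F1_ode:
  fixes z :: real
  assumes c: "c > 0" and z: "\<bar>z\<bar> < 1"
    and G': "(gauss_2F1 (a + 1) (b + 1) (c + 1) has_field_derivative G') (at z)"
  shows "z * (1 - z) * G' + (c - (a + b + 1) * z) * gauss_2F1 (a + 1) (b + 1) (c + 1) z =
           c * gauss_2F1 a b c z"
proof -
  define g where "g = hyp_coeff (a + 1) (b + 1) (c + 1)"
  have g: "(\<lambda>n. g n * z ^ n) sums gauss_2F1 (a + 1) (b + 1) (c + 1) z"
    unfolding g_def using c z by (intro gauss_2F1_sums) auto
  have "G' = (a + 1) * (b + 1) / (c + 1) * gauss_2F1 (a + 1 + 1) (b + 1 + 1) (c + 1 + 1) z"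
    using c z by (intro DERIV_unique[OF G'] has_field_derivative_gauss_2F1) auto
  hence zG: "(\<lambda>n. real n * g n * z ^ n) sums (G' * z)"
    unfolding g_def using c z by (simp only:, intro sums_of_nat_times_hyp_coeff) auto
  have "(\<lambda>n. real n * g n * z ^ n * z + (a + b + 1) * (g n * z ^ n * z)) sums
          (G' * z * z + (a + b + 1) * (gauss_2F1 (a + 1) (b + 1) (c + 1) z * z))"
    by (intro sums_add sums_mult sums_mult2 zG g)
  hence "(\<lambda>n. (real n + a + b + 1) * g n * z ^ Suc n) sums
          (G' * z * z + (a + b + 1) * (gauss_2F1 (a + 1) (b + 1) (c + 1) z * z))"
    by (simp add: algebra_simps)
  \<comment> \<open>The factor \<open>z\<close> moves coefficient \<open>m\<close> to degree
    \<open>m + 1\<close>. The explicit 0 at \<open>n = 0\<close> is essential, since there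
    \<open>n - 1\<close> is again 0 and would refer to \<open>g 0\<close>.\<close>
  from sums_Suc[where f = "\<lambda>n. if n = 0 then 0 else (real (n - 1) + a + b + 1) * g (n - 1) * z ^ n"] this
  have "(\<lambda>n. if n = 0 then 0 else (real (n - 1) + a + b + 1) * g (n - 1) * z ^ n) sums
          (G' * z * z + (a + b + 1) * (gauss_2F1 (a + 1) (b + 1) (c + 1) z * z))"
    by fastforce
  from sums_diff[OF sums_add[OF zG sums_mult[OF g, of c]] this]
  have "(\<lambda>n. real n * g n * z ^ n + c * (g n * z ^ n)
            - (if n = 0 then 0 else (real (n - 1) + a + b + 1) * g (n - 1) * z ^ n)) sums
        (z * (1 - z) * G' + (c - (a + b + 1) * z) * gauss_2F1 (a + 1) (b + 1) (c + 1) z)"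
    by (simp add: algebra_simps)
  also have "(\<lambda>n. real n * g n * z ^ n + c * (g n * z ^ n)
            - (if n = 0 then 0 else (real (n - 1) + a + b + 1) * g (n - 1) * z ^ n)) =
        (\<lambda>n. c * (hyp_coeff a b c n * z ^ n))"
  proof
    fix n
    show "real n * g n * z ^ n + c * (g n * z ^ n)
            - (if n = 0 then 0 else (real (n - 1) + a + b + 1) * g (n - 1) * z ^ n) =
          c * (hyp_coeff a b c n * z ^ n)"
    proof (cases n)
      case (Suc m)
      have "(real m + 1) * (c + 1 + real m) * g (Suc m) = (a + 1 + real m) * (b + 1 + real m) * g m"
        unfolding g_def using c by (intro hyp_coeff_rec) auto
      moreover have "(real m + 1) * c * hyp_coeff a b c (Suc m) = a * b * g m"
        unfolding g_def using c by (rule hyp_coeff_shift)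
      \<comment> \<open>The two recurrences combine because
        \<open>(a + 1 + m) (b + 1 + m) - (m + 1) (m + a + b + 1) = a b\<close>.\<close>
      ultimately have "(real m + 1) * ((real m + 1 + c) * g (Suc m) - (real m + a + b + 1) * g m) =
                       (real m + 1) * (c * hyp_coeff a b c (Suc m))"
        by (simp add: algebra_simps)
      hence "(real m + 1 + c) * g (Suc m) - (real m + a + b + 1) * g m = c * hyp_coeff a b c (Suc m)"
        by (subst (asm) mult_cancel_left) auto
      from arg_cong[OF this, of "\<lambda>x. x * z ^ Suc m"] show ?thesis
        by (simp add: Suc algebra_simps)
    qed (simp add: g_def)
  qed
  finally show ?thesis
    using sums_mult[OF gauss_2F1_sums[OF c z, of a b], of c] by (rule sums_unique2)
qed

subsection \<open>Summation at 1\<close>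

lemma hyp_coeff_pochhammer:
  "hyp_coeff a b c n = pochhammer a n * pochhammer b n / (fact n * pochhammer c n)"
  by (induction n) (simp_all add: hyp_coeff_Suc pochhammer_Suc mult_ac add_ac)

text \<open>As \<open>Gamma_series' x n\<close> tends to \<open>Gamma x\<close>, this turns
  quotients of Pochhammer symbols into powers of \<open>n\<close> and, in the limit, Gamma
  values.\<close>

lemma pochhammer_eq_Gamma_series':
  assumes "x > (0::real)" "n > 0"
  shows "pochhammer x n = fact (n - 1) * real n powr x / Gamma_series' x n"
  using assms pochhammer_pos[of x n] by (simp add: Gamma_series'_def powr_def)

lemma Gamma_series'_pos: "x > (0::real) \<Longrightarrow> Gamma_series' x n > 0"
  using pochhammer_pos[of x n] by (simp add: Gamma_series'_def)

text \<open>The coefficients behave like \<open>n powr (a + b - c - 1)\<close>; the 1 in the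
  exponent comes from \<open>n! = n (n - 1)!\<close>.\<close>

lemma hyp_coeff_asymp:
  assumes "a > 0" "b > 0" "c > 0"
  shows "(\<lambda>n. hyp_coeff a b c n * real n powr (c + 1 - a - b)) \<longlonglongrightarrow> Gamma c / (Gamma a * Gamma b)"
proof (rule Lim_transform_eventually)
  show "(\<lambda>n. Gamma_series' c n / (Gamma_series' a n * Gamma_series' b n))
          \<longlonglongrightarrow> Gamma c / (Gamma a * Gamma b)"
    using assms[THEN Gamma_real_pos] by (intro tendsto_intros Gamma_series'_LIMSEQ) auto
  show "\<forall>\<^sub>F n in sequentially. Gamma_series' c n / (Gamma_series' a n * Gamma_series' b n) =
          hyp_coeff a b c n * real n powr (c + 1 - a - b)"
    using eventually_gt_at_top[of 0]
  proof eventually_elim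
    case (elim n)
    have "fact n = real n * fact (n - 1)" using elim by (simp add: fact_reduce)
    moreover have "real n powr (c + 1 - a - b) = real n * (real n powr c / (real n powr a * real n powr b))"
      using elim by (simp add: powr_diff powr_add)
    ultimately show ?case
      using elim assms[THEN Gamma_series'_pos[of _ n]]
      by (simp add: hyp_coeff_pochhammer pochhammer_eq_Gamma_series' assms field_simps)
  qed
qed

context
  fixes a b c :: real
  assumes a: "a > 0" and b: "b > 0" and c: "c > a + b"
begin

text \<open>Comparison with a power of \<open>n\<close> whose exponent is below -1 exactly because
  \<open>c > a + b\<close>.\<close>

lemma summable_hyp_coeff_1: "summable (hyp_coeff a b c)"
proof (rule summable_comparison_test_bigo)
  show "summable (\<lambda>n. norm (real n powr (a + b - c - 1)))"
    using c by (simp add: summable_real_powr_iff)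
  have "(\<lambda>n. hyp_coeff a b c n / real n powr (a + b - c - 1)) \<longlonglongrightarrow> Gamma c / (Gamma a * Gamma b)"
    using hyp_coeff_asymp[of a b c] a b c by (simp add: powr_diff powr_add mult_ac)
  thus "hyp_coeff a b c \<in> O(\<lambda>n. real n powr (a + b - c - 1))"
    by (rule bigoI_tendsto) (use eventually_gt_at_top[of 0] in eventually_elim, simp)
qed

lemma gauss_2F1_1_sums: "hyp_coeff a b c sums gauss_2F1 a b c 1"
  using gauss_2F1_eq_suminf[of a b c 1] summable_hyp_coeff_1 by (simp add: summable_sums)

text \<open>The order of growth is \<open>n powr (a + b - c)\<close>. This is the boundary term of
  the telescoping sum behind the contiguous relation.\<close>

lemma hyp_coeff_times_n_tendsto_0: "(\<lambda>n. real n * hyp_coeff a b c n) \<longlonglongrightarrow> 0"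
proof (rule Lim_transform_eventually)
  have "(\<lambda>n. real n powr (a + b - c)) \<longlonglongrightarrow> 0"
    using c by real_asymp
  from tendsto_mult[OF hyp_coeff_asymp[of a b c] this]
  show "(\<lambda>n. hyp_coeff a b c n * real n powr (c + 1 - a - b) * real n powr (a + b - c)) \<longlonglongrightarrow> 0"
    using a b c by simp
  show "\<forall>\<^sub>F n in sequentially. hyp_coeff a b c n * real n powr (c + 1 - a - b) * real n powr (a + b - c)
          = real n * hyp_coeff a b c n"
    using eventually_gt_at_top[of 0] by eventually_elim (simp add: mult.assoc flip: powr_add)
qed

end

section \<open>Gauss's summation theorem\<close>

lemma hyp_coeff_plus1:
  assumes "c > 0"
  shows "c * hyp_coeff a b c n = (c + real n) * hyp_coeff a b (c + 1) n"
proof -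
  \<comment> \<open>\<open>pochhammer c (Suc n)\<close> splits off either its first factor
    \<open>c\<close> or its last factor \<open>c + n\<close>.\<close>
  have "c / pochhammer c n = (c + real n) / pochhammer (c + 1) n"
    using pochhammer_rec[of c n] pochhammer_Suc[of c n]
      pochhammer_pos[of c n] pochhammer_pos[of "c + 1" n] assms
    by (simp add: frac_eq_eq mult.commute)
  from arg_cong[OF this, of "\<lambda>x. x * (pochhammer a n * pochhammer b n / fact n)"] show ?thesis
    by (simp add: hyp_coeff_pochhammer mult_ac)
qed

text \<open>Summing \<open>(c - a - b) h\<^sub>n - (c - a) (c - b) / (c + n) h\<^sub>n = n h\<^sub>n - (n + 1) h\<^bsub>n+1\<^esub>\<close>, where \<open>h\<^sub>n\<close> is
  the coefficient of \<open>gauss_2F1 a b c\<close>.\<close>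

lemma gauss_2F1_1_contiguous:
  fixes a b c :: real
  assumes "a > 0" "b > 0" "c > a + b"
  shows "c * (c - a - b) * gauss_2F1 a b c 1 = (c - a) * (c - b) * gauss_2F1 a b (c + 1) 1"
proof -
  have c: "c > 0" using assms by linarith
  \<comment> \<open>\<open>T\<close> is 0 at index 0 and tends to 0, so its differences sum to 0,
    which is the claimed relation.\<close>
  define T where "T n = c * (real n * hyp_coeff a b c n)" for n
  have T: "T \<longlonglongrightarrow> c * 0"
    unfolding T_def by (intro tendsto_intros hyp_coeff_times_n_tendsto_0 assms)
  have "(\<lambda>n. c * (c - a - b) * hyp_coeff a b c n - (c - a) * (c - b) * hyp_coeff a b (c + 1) n) sums
          (c * (c - a - b) * gauss_2F1 a b c 1 - (c - a) * (c - b) * gauss_2F1 a b (c + 1) 1)"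
    by (intro sums_diff sums_mult gauss_2F1_1_sums) (use assms in auto)
  moreover have "c * (c - a - b) * hyp_coeff a b c n - (c - a) * (c - b) * hyp_coeff a b (c + 1) n
                   = T n - T (Suc n)" for n
  proof -
    have "(c + real n) * T (Suc n) = c * ((a + real n) * (b + real n) * hyp_coeff a b c n)"
      unfolding T_def using hyp_coeff_rec[OF c, of n a b] by (simp add: mult_ac add.commute)
    hence "(c + real n) * (T n - T (Suc n)) =
           (c + real n) * (c * (c - a - b) * hyp_coeff a b c n) - (c - a) * (c - b) * (c * hyp_coeff a b c n)"
      unfolding T_def by (simp add: algebra_simps)
    also have "\<dots> = (c + real n) *
        (c * (c - a - b) * hyp_coeff a b c n - (c - a) * (c - b) * hyp_coeff a b (c + 1) n)"
      unfolding hyp_coeff_plus1[OF c] by (simp add: algebra_simps)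
    finally show ?thesis using c by auto
  qed
  ultimately have "(\<lambda>n. T n - T (Suc n)) sums
      (c * (c - a - b) * gauss_2F1 a b c 1 - (c - a) * (c - b) * gauss_2F1 a b (c + 1) 1)"
    by simp
  moreover have "(\<lambda>n. T n - T (Suc n)) sums (T 0 - 0)"
    using telescope_sums'[OF T] by simp
  ultimately show ?thesis
    using sums_unique2 by (fastforce simp: T_def)
qed

text \<open>Replacing \<open>c\<close> by \<open>c + m\<close> scales the first factor of each
  nonconstant coefficient by \<open>c / (c + m)\<close> and does not increase the others. Everything
  beyond the constant term is therefore at most \<open>c / (c + m)\<close> times a fixed
  number.\<close>

lemma gauss_2F1_1_tendsto_1:
  fixes a b c :: real
  assumes "a > 0" "b > 0" "c > a + b"
  shows "(\<lambda>m. gauss_2F1 a b (c + real m) 1) \<longlonglongrightarrow> 1"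
proof (rule tendsto_sandwich)
  have c: "c > 0" using assms by linarith
  have le: "hyp_coeff a b (c + real m) (Suc n) \<le> c / (c + real m) * hyp_coeff a b c (Suc n)" for m n
  proof (induction n)
    case (Suc n)
    have "(a + real (Suc n)) * (b + real (Suc n)) / ((real (Suc n) + 1) * (c + real m + real (Suc n)))
            \<le> (a + real (Suc n)) * (b + real (Suc n)) / ((real (Suc n) + 1) * (c + real (Suc n)))"
      using assms c by (intro divide_left_mono mult_left_mono mult_pos_pos mult_nonneg_nonneg) auto
    from mult_mono[OF Suc.IH this] show ?case
      using assms c hyp_coeff_nonneg[of a b c "Suc n"]
      by (subst (1 2) hyp_coeff_Suc) (auto simp: mult.assoc intro!: mult_nonneg_nonneg divide_nonneg_nonneg)
  qed (use assms c in \<open>simp add: hyp_coeff_Suc\<close>)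
  have Suc_sums: "(\<lambda>n. hyp_coeff a b d (Suc n)) sums (gauss_2F1 a b d 1 - 1)" if "d > a + b" for d
    using gauss_2F1_1_sums[OF assms(1,2) that] by (subst sums_Suc_iff) simp
  have "gauss_2F1 a b (c + real m) 1 - 1 \<le> c / (c + real m) * (gauss_2F1 a b c 1 - 1)" for m
    by (rule sums_le[OF le Suc_sums sums_mult[OF Suc_sums]]) (use assms in auto)
  thus "\<forall>\<^sub>F m in sequentially. gauss_2F1 a b (c + real m) 1 \<le> 1 + c / (c + real m) * (gauss_2F1 a b c 1 - 1)"
    by (intro always_eventually allI) (smt (verit))
  have "0 \<le> gauss_2F1 a b (c + real m) 1 - 1" for m
    by (rule sums_le[OF hyp_coeff_nonneg sums_zero Suc_sums]) (use assms c in auto)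
  thus "\<forall>\<^sub>F m in sequentially. 1 \<le> gauss_2F1 a b (c + real m) 1"
    by (intro always_eventually allI) simp
  have "(\<lambda>m. c / (c + real m)) \<longlonglongrightarrow> 0" by real_asymp
  from tendsto_add[OF tendsto_const[of 1] tendsto_mult[OF this tendsto_const[of "gauss_2F1 a b c 1 - 1"]]]
  show "(\<lambda>m. 1 + c / (c + real m) * (gauss_2F1 a b c 1 - 1)) \<longlonglongrightarrow> 1" by simp
qed simp

text \<open>Iterating the contiguous relation \<open>m\<close> times yields \<open>R m\<close> times
  the value for \<open>c + m\<close>. That value tends to 1, \<open>R m\<close> tends to the Gamma
  quotient, and the product does not depend on \<open>m\<close>.\<close>

lemma gauss_summation:
  fixes a b c :: real
  assumes "a > 0" "b > 0" "c > a + b"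
  shows "gauss_2F1 a b c 1 = Gamma c * Gamma (c - a - b) / (Gamma (c - a) * Gamma (c - b))"
proof -
  have pos: "c > 0" "c - a > 0" "c - b > 0" "c - a - b > 0" using assms by auto
  define R where "R m = pochhammer (c - a) m * pochhammer (c - b) m /
                         (pochhammer c m * pochhammer (c - a - b) m)" for m
  have eq: "gauss_2F1 a b c 1 = R m * gauss_2F1 a b (c + real m) 1" for m
  proof (induction m)
    case (Suc m)
    have pos': "c + real m > 0" "c + real m - a - b > 0" using assms by auto
    have "(c + real m) * (c - a - b + real m) * gauss_2F1 a b (c + real m) 1 =
          (c - a + real m) * (c - b + real m) * gauss_2F1 a b (c + real (Suc m)) 1"
      using gauss_2F1_1_contiguous[of a b "c + real m"] assms pos' by (simp add: algebra_simps)
    moreover have "(c + real m) * (c - a - b + real m) \<noteq> 0" using pos' by auto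
    ultimately have "gauss_2F1 a b (c + real m) 1 = (c - a + real m) * (c - b + real m) /
            ((c + real m) * (c - a - b + real m)) * gauss_2F1 a b (c + real (Suc m)) 1"
      by (metis nonzero_mult_div_cancel_left times_divide_eq_left)
    thus ?case by (subst Suc.IH) (simp add: R_def pochhammer_Suc mult_ac)
  qed (simp add: R_def)
  have "R \<longlonglongrightarrow> Gamma c * Gamma (c - a - b) / (Gamma (c - a) * Gamma (c - b))"
  proof (rule Lim_transform_eventually)
    show "(\<lambda>m. Gamma_series' c m * Gamma_series' (c - a - b) m /
            (Gamma_series' (c - a) m * Gamma_series' (c - b) m)) \<longlonglongrightarrow>
          Gamma c * Gamma (c - a - b) / (Gamma (c - a) * Gamma (c - b))"
      using pos[THEN Gamma_real_pos] by (intro tendsto_intros Gamma_series'_LIMSEQ) auto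
    \<comment> \<open>Factorials and powers of \<open>m\<close> cancel, since
      \<open>c + (c - a - b) = (c - a) + (c - b)\<close>.\<close>
    show "\<forall>\<^sub>F m in sequentially. Gamma_series' c m * Gamma_series' (c - a - b) m /
            (Gamma_series' (c - a) m * Gamma_series' (c - b) m) = R m"
      using eventually_gt_at_top[of 0]
    proof eventually_elim
      case (elim m)
      thus ?case
        using pos[THEN Gamma_series'_pos[of _ m]]
        unfolding R_def pos[THEN pochhammer_eq_Gamma_series', OF elim]
        by (simp add: powr_diff powr_add field_simps)
    qed
  qed
  hence "(\<lambda>m. R m * gauss_2F1 a b (c + real m) 1) \<longlonglongrightarrow>
           Gamma c * Gamma (c - a - b) / (Gamma (c - a) * Gamma (c - b)) * 1"
    by (intro tendsto_mult gauss_2F1_1_tendsto_1 assms)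
  thus ?thesis
    by (simp flip: eq add: LIMSEQ_const_iff)
qed

text \<open>Weierstrass M-test with the coefficients themselves as majorant. The endpoint 1 is what
  matters: it makes \<open>gauss_summation\<close> usable for limits.\<close>

lemma continuous_on_gauss_2F1_unit_interval:
  fixes a b c :: real
  assumes "a > 0" "b > 0" "c > a + b"
  shows "continuous_on {0..1} (gauss_2F1 a b c)"
proof -
  have c: "c > 0" using assms by linarith
  have bd: "norm (hyp_coeff a b c n * z ^ n) \<le> hyp_coeff a b c n" if "z \<in> {0..1}" for n and z :: real
    using hyp_coeff_nonneg[of a b c n] assms c that
    by (auto simp: abs_mult power_abs power_le_one intro: mult_left_le)
  have "uniform_limit {0..1} (\<lambda>N z. \<Sum>n<N. hyp_coeff a b c n * z ^ n)
          (\<lambda>z. \<Sum>n. hyp_coeff a b c n * z ^ n) sequentially"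
    by (rule Weierstrass_m_test[OF bd summable_hyp_coeff_1[OF assms]])
  hence "continuous_on {0..1} (\<lambda>z. \<Sum>n. hyp_coeff a b c n * z ^ n)"
    by (rule uniform_limit_theorem[rotated]) (auto intro!: always_eventually continuous_intros)
  moreover have "(\<Sum>n. hyp_coeff a b c n * z ^ n) = gauss_2F1 a b c z" if "z \<in> {0..1}" for z
    using bd[OF that]
    by (intro gauss_2F1_eq_suminf[symmetric] summable_comparison_test'[OF summable_hyp_coeff_1[OF assms], of 0])
  ultimately show ?thesis by (rule continuous_on_eq)
qed

subsection \<open>Transformations\<close>

text \<open>Solutions that are regular at a zero \<open>w\<close> of \<open>p\<close> are determined by their value there,
  because their Wronskian, multiplied by \<open>p\<close>, is constant.\<close>

lemma singular_ode_unique: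
  fixes y v :: "real \<Rightarrow> real"
  assumes S: "convex S" "w \<in> S" and p: "p w = 0" "\<And>x. x \<in> S - {w} \<Longrightarrow> p x \<noteq> 0"
    and y: "\<And>x. x \<in> S \<Longrightarrow> (y has_field_derivative y' x) (at x within S)"
    and v: "\<And>x. x \<in> S \<Longrightarrow> (v has_field_derivative v' x) (at x within S)"
    and Y_eq: "\<And>x. x \<in> S \<Longrightarrow> Y x = p x * y' x"
    and V_eq: "\<And>x. x \<in> S \<Longrightarrow> V x = p x * v' x"
    and cont: "continuous_on S Y" "continuous_on S V"
    and Y: "\<And>x. x \<in> S - {w} \<Longrightarrow> (Y has_field_derivative r x * y x) (at x within S)"
    and V: "\<And>x. x \<in> S - {w} \<Longrightarrow> (V has_field_derivative r x * v x) (at x within S)"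
    and nz: "\<And>x. x \<in> S \<Longrightarrow> y x \<noteq> 0" and init: "v w = y w" and x: "x \<in> S"
  shows "v x = y x"
proof -
  have cont': "continuous_on S y" "continuous_on S v"
    using y v by (auto intro: DERIV_continuous_on)
  \<comment> \<open>The weighted Wronskian vanishes at \<open>w\<close> because \<open>p\<close>
    does, and its derivative off \<open>w\<close> is
    \<open>r y v - r v y + p y' v' - p v' y' = 0\<close>.\<close>
  have W: "Y x * v x - V x * y x = 0" if "x \<in> S" for x
  proof (rule has_derivative_zero_unique_strong_convex[where f = "\<lambda>x. Y x * v x - V x * y x"
        and S = S and K = "{w}" and c = w and x = x])
    show "continuous_on S (\<lambda>x. Y x * v x - V x * y x)"
      by (intro continuous_intros cont cont')
    show "Y w * v w - V w * y w = 0"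
      using S by (simp add: Y_eq V_eq p)
    fix x assume x: "x \<in> S - {w}"
    have "((\<lambda>x. Y x * v x - V x * y x) has_field_derivative 0) (at x within S)"
      using x by (auto intro!: derivative_eq_intros Y V y v simp: Y_eq V_eq)
    thus "((\<lambda>x. Y x * v x - V x * y x) has_derivative (\<lambda>h. 0)) (at x within S)"
      by (simp add: has_field_derivative_def lambda_zero)
  qed (use S that in auto)
  \<comment> \<open>Off \<open>w\<close> the factor \<open>p\<close> can be cancelled from the
    Wronskian, so \<open>v / y\<close> has derivative 0 there; continuity carries the constant
    across \<open>w\<close>.\<close>
  have "v x / y x = 1"
  proof (rule has_derivative_zero_unique_strong_convex[where f = "\<lambda>x. v x / y x"
        and S = S and K = "{w}" and c = w and x = x])
    show "continuous_on S (\<lambda>x. v x / y x)"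
      by (intro continuous_intros cont' ballI nz)
    show "v w / y w = 1" using nz S init by simp
    fix x assume x: "x \<in> S - {w}"
    have "p x * (y' x * v x - v' x * y x) = 0"
      using W[of x] x by (simp add: Y_eq V_eq right_diff_distrib mult.assoc)
    hence "v' x * y x - v x * y' x = 0" using p(2)[OF x] by (simp add: mult.commute)
    hence "((\<lambda>x. v x / y x) has_field_derivative 0) (at x within S)"
      using x nz by (auto intro!: derivative_eq_intros y v)
    thus "((\<lambda>x. v x / y x) has_derivative (\<lambda>h. 0)) (at x within S)"
      by (simp add: has_field_derivative_def lambda_zero)
  qed (use S x in auto)
  thus ?thesis using nz[OF x] by simp
qed

text \<open>With \<open>s = c - a - b\<close>, both sides solve \<open>(p y')' = r y\<close> for
  \<open>p = z^c (1 - z)^(1 - s)\<close> and \<open>r = a b z^(c - 1) (1 - z)^(-s)\<close>, and both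
  are 1 at 0. The right-hand side is positive on \<open>[0, 1)\<close>, so
  \<open>singular_ode_unique\<close> applies.\<close>

lemma euler_transformation:
  fixes a b c z :: real
  assumes "a > 0" "b > 0" "c > 0" "0 \<le> z" "z < 1"
  shows "(1 - z) powr (c - a - b) * gauss_2F1 (c - a) (c - b) c z = gauss_2F1 a b c z"
proof -
  define s where "s = c - a - b"
  define G where "G = gauss_2F1 (a + 1) (b + 1) (c + 1)"
  define G' where "G' z = (a + 1) * (b + 1) / (c + 1) * gauss_2F1 (a + 1 + 1) (b + 1 + 1) (c + 1 + 1) z" for z
  define D where "D = gauss_2F1 (c - a + 1) (c - b + 1) (c + 1)"
  define D' where "D' z = (c - a + 1) * (c - b + 1) / (c + 1) *
    gauss_2F1 (c - a + 1 + 1) (c - b + 1 + 1) (c + 1 + 1) z" for z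
  define E where "E = gauss_2F1 (c - a) (c - b) c"
  define e where "e = (c - a) * (c - b) / c"
  define y' where "y' z = a * b / c * G z" for z
  \<comment> \<open>The power \<open>(1 - z) powr (s - 1)\<close> is pulled out because it cancels
    against the one in \<open>p\<close>.\<close>
  define v' where "v' z = (1 - z) powr (s - 1) * (- s * E z + (1 - z) * e * D z)" for z
  define p where "p z = z powr c * (1 - z) powr (1 - s)" for z
  have G: "(G has_field_derivative G' z) (at z)" if "\<bar>z\<bar> < 1" for z
    unfolding G_def G'_def using assms that by (intro has_field_derivative_gauss_2F1) auto
  have D: "(D has_field_derivative D' z) (at z)" if "\<bar>z\<bar> < 1" for z
    unfolding D_def D'_def using assms that by (intro has_field_derivative_gauss_2F1) auto
  have E: "(E has_field_derivative e * D z) (at z)" if "\<bar>z\<bar> < 1" for z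
    unfolding E_def D_def e_def using assms that by (intro has_field_derivative_gauss_2F1) auto
  have odeG: "z * (1 - z) * G' z + (c - (a + b + 1) * z) * G z = c * gauss_2F1 a b c z" if "\<bar>z\<bar> < 1" for z
    using gauss_2F1_ode[OF assms(3) that G[OF that, unfolded G_def]] by (simp add: G_def)
  have odeD: "z * (1 - z) * D' z + (c - ((c - a) + (c - b) + 1) * z) * D z = c * E z" if "\<bar>z\<bar> < 1" for z
    using gauss_2F1_ode[OF assms(3) that D[OF that, unfolded D_def]] by (simp add: D_def E_def)
  have contG: "continuous_on {0..<1} G" and contD: "continuous_on {0..<1} D" and contE: "continuous_on {0..<1} E"
    unfolding G_def D_def E_def using assms by (auto intro!: continuous_intros)
  have powc: "((\<lambda>z. z powr c) has_field_derivative c * z powr (c - 1)) (at z)" if "z > 0" for z :: real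
    using has_real_derivative_powr[OF that, of c] .
  have pow1: "((\<lambda>z. (1 - z) powr t) has_field_derivative - (t * (1 - z) powr (t - 1))) (at z)" if "z < 1" for z t :: real
    using DERIV_chain2[where f = "\<lambda>z. z powr t" and g = "\<lambda>z. 1 - z" and x = z,
        OF has_real_derivative_powr[of "1 - z" t], of "-1"] that
    by (auto intro!: derivative_eq_intros)
  have "(1 - z) powr s * E z = gauss_2F1 a b c z"
  proof (rule singular_ode_unique[where x = z and y = "gauss_2F1 a b c"
      and v = "\<lambda>z. (1 - z) powr s * E z" and w = 0 and S = "{0..<1}" and p = p and y' = y' and v' = v'
      and Y = "\<lambda>z. a * b / c * (z powr c * (1 - z) powr (1 - s) * G z)"
      and V = "\<lambda>z. z powr c * (- s * E z + (1 - z) * e * D z)"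
      and r = "\<lambda>z. a * b * z powr (c - 1) * (1 - z) powr (- s)"])
    fix z :: real assume z: "z \<in> {0..<1}"
    show "(gauss_2F1 a b c has_field_derivative y' z) (at z within {0..<1})"
      unfolding y'_def G_def using z assms
      by (intro DERIV_subset[OF has_field_derivative_gauss_2F1]) auto
    have B: "(1 - z) powr s = (1 - z) * (1 - z) powr (s - 1)"
      using z by (simp add: powr_diff)
    have "((\<lambda>z. (1 - z) powr s * E z) has_field_derivative
             - (s * (1 - z) powr (s - 1)) * E z + e * D z * (1 - z) powr s) (at z)"
      using z by (intro DERIV_mult pow1 E) auto
    also have "- (s * (1 - z) powr (s - 1)) * E z + e * D z * (1 - z) powr s = v' z"
      unfolding v'_def B by (simp add: algebra_simps)
    finally show "((\<lambda>z. (1 - z) powr s * E z) has_field_derivative v' z) (at z within {0..<1})"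
      by (rule DERIV_subset) auto
    show "a * b / c * (z powr c * (1 - z) powr (1 - s) * G z) = p z * y' z"
      by (simp add: p_def y'_def)
    have "(1 - z) powr (1 - s) * (1 - z) powr (s - 1) = 1"
      using z by (simp flip: powr_add)
    thus "z powr c * (- s * E z + (1 - z) * e * D z) = p z * v' z"
      by (simp add: p_def v'_def mult.assoc)
    show "gauss_2F1 a b c z \<noteq> 0"
      using gauss_2F1_pos[of a b c z] assms z by simp
  next
    fix z :: real assume z: "z \<in> {0..<1} - {0}"
    hence z': "z > 0" "z < 1" "\<bar>z\<bar> < 1" by auto
    define A where "A = z powr (c - 1)"
    define B where "B = (1 - z) powr (- s)"
    have A: "z powr c = z * A" using z' by (simp add: A_def powr_diff)
    have B: "(1 - z) powr (1 - s) = (1 - z) * B" using z' by (simp add: B_def powr_diff powr_minus_divide)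
    have B': "(1 - z) powr s * B = 1" using z' by (simp add: B_def flip: powr_add)
    show "p z \<noteq> 0" using z' by (simp add: p_def)
    have exps: "1 - s - 1 = - s" by simp
    \<comment> \<open>This is \<open>z (1 - z) p' / p\<close>, so differentiating \<open>p G\<close>
      reproduces the left-hand side of \<open>odeG\<close>.\<close>
    have coef: "c - (a + b + 1) * z = c * (1 - z) - (1 - s) * z" by (simp add: s_def algebra_simps)
    have "((\<lambda>z. a * b / c * (z powr c * (1 - z) powr (1 - s) * G z)) has_field_derivative
            a * b / c * ((c * z powr (c - 1) * (1 - z) powr (1 - s)
              + - ((1 - s) * (1 - z) powr (1 - s - 1)) * z powr c) * G z
              + G' z * (z powr c * (1 - z) powr (1 - s)))) (at z)"
      using z' by (intro DERIV_cmult DERIV_mult powc pow1 G)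
    also have "a * b / c * ((c * z powr (c - 1) * (1 - z) powr (1 - s)
              + - ((1 - s) * (1 - z) powr (1 - s - 1)) * z powr c) * G z
              + G' z * (z powr c * (1 - z) powr (1 - s))) =
          a * b / c * A * B * (z * (1 - z) * G' z + (c - (a + b + 1) * z) * G z)"
      unfolding A B exps coef A_def[symmetric] B_def[symmetric] by algebra
    also have "\<dots> = a * b * z powr (c - 1) * (1 - z) powr (- s) * gauss_2F1 a b c z"
      unfolding odeG[OF z'(3)] using assms by (simp add: A_def B_def)
    finally show "((\<lambda>z. a * b / c * (z powr c * (1 - z) powr (1 - s) * G z)) has_field_derivative
        a * b * z powr (c - 1) * (1 - z) powr (- s) * gauss_2F1 a b c z) (at z within {0..<1})"
      by (rule DERIV_subset) auto
    have "((\<lambda>z. z powr c * (- s * E z + (1 - z) * e * D z)) has_field_derivative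
            c * z powr (c - 1) * (- s * E z + (1 - z) * e * D z) +
            (- s * (e * D z) + (- e * D z + D' z * ((1 - z) * e))) * z powr c) (at z)"
      using z' by (intro DERIV_mult powc DERIV_add DERIV_cmult D E) (auto intro!: derivative_eq_intros)
    also have "c * z powr (c - 1) * (- s * E z + (1 - z) * e * D z) +
            (- s * (e * D z) + (- e * D z + D' z * ((1 - z) * e))) * z powr c =
          A * (e * (z * (1 - z) * D' z + (c - ((c - a) + (c - b) + 1) * z) * D z) - c * s * E z)"
      unfolding A by (simp add: A_def[symmetric] s_def algebra_simps)
    also have "\<dots> = A * (c * e - c * s) * E z"
      unfolding odeD[OF z'(3)] by (simp add: algebra_simps)
    also have "c * e = (c - a) * (c - b)"
      using assms by (simp add: e_def)
    also have "(c - a) * (c - b) - c * s = a * b"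
      by (simp add: s_def algebra_simps)
    also have "A * (a * b) * E z = a * b * A * B * ((1 - z) powr s * E z)"
      using B' by (simp add: mult_ac)
    finally show "((\<lambda>z. z powr c * (- s * E z + (1 - z) * e * D z)) has_field_derivative
        a * b * z powr (c - 1) * (1 - z) powr (- s) * ((1 - z) powr s * E z)) (at z within {0..<1})"
      unfolding A_def B_def by (rule DERIV_subset) auto
  next
    show "continuous_on {0..<1} (\<lambda>z. a * b / c * (z powr c * (1 - z) powr (1 - s) * G z))"
         "continuous_on {0..<1} (\<lambda>z. z powr c * (- s * E z + (1 - z) * e * D z))"
      using assms by (auto intro!: continuous_intros continuous_on_powr' contG contD contE)
  qed (use assms in \<open>auto simp: p_def E_def\<close>)
  thus ?thesis by (simp add: s_def E_def)
qed

section \<open>The cubic transformation\<close>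

lemma cubic_arg_bounds:
  fixes x :: real
  assumes "x \<in> {-1/2<..0}"
  shows "0 < (1 + 2 * x) / (1 - x)" "(1 + 2 * x) / (1 - x) \<le> 1"
    "1 - ((1 + 2 * x) / (1 - x)) ^ 3 \<in> {0..<1}"
    "\<bar>1 - ((1 + 2 * x) / (1 - x)) ^ 3\<bar> < 1" "\<bar>x ^ 3\<bar> < 1"
proof -
  show t: "0 < (1 + 2 * x) / (1 - x)" "(1 + 2 * x) / (1 - x) \<le> 1"
    using assms by (auto simp: divide_simps)
  show u: "1 - ((1 + 2 * x) / (1 - x)) ^ 3 \<in> {0..<1}"
    using zero_less_power[OF t(1), of 3] power_le_one[of _ 3, OF less_imp_le[OF t(1)] t(2)] by simp
  then show "\<bar>1 - ((1 + 2 * x) / (1 - x)) ^ 3\<bar> < 1" by auto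
  show "\<bar>x ^ 3\<bar> < 1"
    using assms power_less_one_iff[of "\<bar>x\<bar>" 3] by (simp add: power_abs)
qed

lemma cubic_arg_deriv:
  fixes x :: real
  assumes "x \<noteq> 1"
  shows "((\<lambda>x. (1 + 2 * x) / (1 - x)) has_field_derivative 3 / (1 - x)\<^sup>2) (at x)"
  using assms by (auto intro!: derivative_eq_intros simp: power2_eq_square field_simps)

text \<open>Both this derivative and the next one serve twice: in the uniqueness argument, and when
  the finished transformation is differentiated.\<close>

lemma cubic_lhs_deriv:
  fixes x :: real
  assumes "\<bar>x ^ 3\<bar> < 1"
  shows "((\<lambda>x. (1 - x) * gauss_2F1 (1/3) (2/3) 1 (x ^ 3)) has_field_derivative
           (1 - x) * (2/3 * x\<^sup>2 * gauss_2F1 (4/3) (5/3) 2 (x ^ 3)) - gauss_2F1 (1/3) (2/3) 1 (x ^ 3)) (at x)"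
  using assms by (auto intro!: derivative_eq_intros)

lemma cubic_rhs_deriv:
  fixes x :: real
  defines "t \<equiv> \<lambda>x. (1 + 2 * x) / (1 - x)"
  assumes "x \<in> {-1/2<..0}"
  shows "((\<lambda>x. gauss_2F1 (1/3) (1/3) 1 (1 - t x ^ 3)) has_field_derivative
           - ((t x)\<^sup>2 / (1 - x)\<^sup>2 * gauss_2F1 (4/3) (4/3) 2 (1 - t x ^ 3))) (at x)"
proof -
  have "(t has_field_derivative 3 / (1 - x)\<^sup>2) (at x)"
    unfolding t_def using assms by (intro cubic_arg_deriv) auto
  moreover have "\<bar>1 - t x ^ 3\<bar> < 1"
    using cubic_arg_bounds(4)[OF assms(2)] by (simp only: t_def)
  ultimately show ?thesis
    by (auto intro!: derivative_eq_intros)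
qed

text \<open>Composed with a Pfaff transformation on the right, this is the cubic transformation
  \<open>2F1(1/3, 2/3; 1; 1 - ((1 - x)/(1 + 2x))\<^sup>3) = (1 + 2x) 2F1(1/3, 2/3; 1; x\<^sup>3)\<close> of the Borwein brothers.
  Both sides satisfy \<open>(p y')' = r y\<close> with \<open>p = x (1 - x\<^sup>3) / (1 - x)\<^sup>2\<close> and \<open>r = - (1 + 2x) / (1 - x)\<^sup>3\<close>.\<close>

lemma cubic_transformation:
  fixes x :: real
  assumes x: "x \<in> {-1/2<..0}"
  shows "(1 - x) * gauss_2F1 (1/3) (2/3) 1 (x ^ 3) =
           gauss_2F1 (1/3) (1/3) 1 (1 - ((1 + 2 * x) / (1 - x)) ^ 3)"
proof -
  define t where "t = (\<lambda>x::real. (1 + 2 * x) / (1 - x))"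
  define u where "u x = 1 - t x ^ 3" for x
  define H where "H = gauss_2F1 (1/3) (1/3) (1::real)"
  define F where "F = gauss_2F1 (1/3) (2/3) (1::real)"
  define G where "G = gauss_2F1 (4/3) (4/3) (2::real)"
  define G' where "G' z = (4/3) * (4/3) / 2 * gauss_2F1 (4/3 + 1) (4/3 + 1) (2 + 1) z" for z :: real
  define D where "D = gauss_2F1 (4/3) (5/3) (2::real)"
  define D' where "D' z = (4/3) * (5/3) / 2 * gauss_2F1 (4/3 + 1) (5/3 + 1) (2 + 1) z" for z :: real
  define p where "p x = x * (1 - x ^ 3) / (1 - x)\<^sup>2" for x :: real
  define r where "r x = - ((1 + 2 * x) / (1 - x) ^ 3)" for x :: real
  have G: "(G has_field_derivative G' z) (at z)" if "\<bar>z\<bar> < 1" for z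
    unfolding G_def G'_def using that by (intro has_field_derivative_gauss_2F1) auto
  have D: "(D has_field_derivative D' z) (at z)" if "\<bar>z\<bar> < 1" for z
    unfolding D_def D'_def using that by (intro has_field_derivative_gauss_2F1) auto
  have F: "(F has_field_derivative 2/9 * D z) (at z)" if "\<bar>z\<bar> < 1" for z
    unfolding F_def D_def using has_field_derivative_gauss_2F1[of 1 z "1/3" "2/3"] that by simp
  have odeG: "z * (1 - z) * G' z + (1 - 5/3 * z) * G z = H z" if "\<bar>z\<bar> < 1" for z
    using gauss_2F1_ode[of 1 z "1/3" "1/3" "G' z"] G[OF that] that by (simp add: G_def H_def)
  have odeD: "z * (1 - z) * D' z + (1 - 2 * z) * D z = F z" if "\<bar>z\<bar> < 1" for z
    using gauss_2F1_ode[of 1 z "1/3" "2/3" "D' z"] D[OF that] that by (simp add: D_def F_def)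
  have bounds: "0 < t x" "u x \<in> {0..<1}" "\<bar>u x\<bar> < 1" "\<bar>x ^ 3\<bar> < 1" if "x \<in> {-1/2<..0}" for x
    using cubic_arg_bounds[OF that] by (simp_all only: t_def u_def)
  have nz: "1 - x \<noteq> 0" if "x \<in> {-1/2<..0}" for x :: real
    using that by auto
  \<comment> \<open>The function is \<open>p y'\<close> for \<open>y = H (u x)\<close>, because
    \<open>u = - 9 p / (1 - x)^2\<close>.\<close>
  have Y: "((\<lambda>x. u x * (t x)\<^sup>2 * G (u x) / 9) has_field_derivative r x * H (u x)) (at x within {-1/2<..0})"
    if x: "x \<in> {-1/2<..0}" for x
  proof -
    define i where "i = 1 / (1 - x)"
    have t_eq: "t x = (1 + 2 * x) * i" by (simp add: t_def i_def)
    have t: "(t has_field_derivative 3 * i\<^sup>2) (at x)"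
      unfolding t_def i_def using cubic_arg_deriv[of x] nz[OF x] by (simp add: power_divide)
    have u: "(u has_field_derivative - (9 * (t x)\<^sup>2 * i\<^sup>2)) (at x)"
      unfolding u_def by (auto intro!: derivative_eq_intros t)
    have "((\<lambda>x. u x * (t x)\<^sup>2 * G (u x) / 9) has_field_derivative
            ((- (9 * (t x)\<^sup>2 * i\<^sup>2) * (t x)\<^sup>2 + 6 * t x * i\<^sup>2 * u x) * G (u x)
              - G' (u x) * (9 * (t x)\<^sup>2 * i\<^sup>2) * (u x * (t x)\<^sup>2)) / 9) (at x)"
      using DERIV_chain2[where f = G and g = u, OF G[OF bounds(3)[OF x]] u] by (auto intro!: derivative_eq_intros u t)
    also have "((- (9 * (t x)\<^sup>2 * i\<^sup>2) * (t x)\<^sup>2 + 6 * t x * i\<^sup>2 * u x) * G (u x)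
              - G' (u x) * (9 * (t x)\<^sup>2 * i\<^sup>2) * (u x * (t x)\<^sup>2)) / 9 =
          - (t x * i\<^sup>2) * (u x * t x ^ 3 * G' (u x) + (t x ^ 3 - 2/3 * u x) * G (u x))"
      by (simp add: field_simps power2_eq_square power3_eq_cube)
    \<comment> \<open>Eliminating \<open>t^3\<close> turns the bracket into the left-hand side of
      \<open>odeG\<close>.\<close>
    also have "t x ^ 3 = 1 - u x" by (simp add: u_def)
    also have "1 - u x - 2/3 * u x = 1 - 5/3 * u x" by simp
    also note odeG[OF bounds(3)[OF x]]
    also have "- (t x * i\<^sup>2) = r x"
      by (simp add: r_def t_eq i_def power2_eq_square power3_eq_cube)
    finally show ?thesis by (rule DERIV_subset) auto
  qed
  \<comment> \<open>This is \<open>p v'\<close> for \<open>v = (1 - x) F(x^3)\<close>, simplified by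
    \<open>x (1 - x^3) / (1 - x) = x + x^2 + x^3\<close>.\<close>
  have V: "((\<lambda>x. 2/3 * (x ^ 3 + x ^ 4 + x ^ 5) * D (x ^ 3) - (x + x\<^sup>2 + x ^ 3) / (1 - x) * F (x ^ 3))
      has_field_derivative r x * ((1 - x) * F (x ^ 3))) (at x within {-1/2<..0})"
    if x: "x \<in> {-1/2<..0}" for x
  proof -
    define i where "i = 1 / (1 - x)"
    have i: "i * (1 - x) = 1" using nz[OF x] by (simp add: i_def)
    have q: "((\<lambda>x. (x + x\<^sup>2 + x ^ 3) / (1 - x)) has_field_derivative
            (1 + 2 * x + 2 * x\<^sup>2 - 2 * x ^ 3) * i\<^sup>2) (at x)"
      unfolding i_def using nz[OF x]
      by (auto intro!: derivative_eq_intros simp: divide_simps) algebra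
    have cube: "((\<lambda>x. x ^ 3) has_field_derivative 3 * x\<^sup>2) (at x)"
      by (auto intro!: derivative_eq_intros)
    have "((\<lambda>x. 2/3 * (x ^ 3 + x ^ 4 + x ^ 5) * D (x ^ 3) - (x + x\<^sup>2 + x ^ 3) / (1 - x) * F (x ^ 3))
        has_field_derivative 2/3 * (3 * x\<^sup>2 + 4 * x ^ 3 + 5 * x ^ 4) * D (x ^ 3) +
          D' (x ^ 3) * (3 * x\<^sup>2) * (2/3 * (x ^ 3 + x ^ 4 + x ^ 5)) -
          ((1 + 2 * x + 2 * x\<^sup>2 - 2 * x ^ 3) * i\<^sup>2 * F (x ^ 3) +
           2/9 * D (x ^ 3) * (3 * x\<^sup>2) * ((x + x\<^sup>2 + x ^ 3) / (1 - x)))) (at x)"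
      by (intro DERIV_diff DERIV_mult q DERIV_chain2[where f = D and g = "\<lambda>x. x ^ 3", OF D cube]
          DERIV_chain2[where f = F and g = "\<lambda>x. x ^ 3", OF F cube] bounds(4)[OF x])
         (auto intro!: derivative_eq_intros)
    also have "2/3 * (3 * x\<^sup>2 + 4 * x ^ 3 + 5 * x ^ 4) * D (x ^ 3) +
          D' (x ^ 3) * (3 * x\<^sup>2) * (2/3 * (x ^ 3 + x ^ 4 + x ^ 5)) -
          ((1 + 2 * x + 2 * x\<^sup>2 - 2 * x ^ 3) * i\<^sup>2 * F (x ^ 3) +
           2/9 * D (x ^ 3) * (3 * x\<^sup>2) * ((x + x\<^sup>2 + x ^ 3) / (1 - x))) =
        r x * ((1 - x) * F (x ^ 3))"
    proof -
      \<comment> \<open>In terms of \<open>i\<close> the claim is a polynomial identity modulo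
        \<open>i (1 - x) = 1\<close> and \<open>odeD\<close>.\<close>
      have e: "(x + x\<^sup>2 + x ^ 3) / (1 - x) = (x + x\<^sup>2 + x ^ 3) * i" "r x = - ((1 + 2 * x) * i ^ 3)"
        by (simp_all add: i_def r_def power_divide)
      show ?thesis
        unfolding e using i odeD[OF bounds(4)[OF x]] by algebra
    qed
    finally show ?thesis by (rule DERIV_subset) auto
  qed
  have "(1 - x) * F (x ^ 3) = H (u x)"
  proof (rule singular_ode_unique[where S = "{-1/2<..0}" and w = 0 and p = p and r = r and x = x
      and y = "\<lambda>x. H (u x)" and v = "\<lambda>x. (1 - x) * F (x ^ 3)"
      and y' = "\<lambda>x. - ((t x)\<^sup>2 / (1 - x)\<^sup>2 * G (u x))"
      and v' = "\<lambda>x. (1 - x) * (2/3 * x\<^sup>2 * D (x ^ 3)) - F (x ^ 3)"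
      and Y = "\<lambda>x. u x * (t x)\<^sup>2 * G (u x) / 9"
      and V = "\<lambda>x. 2/3 * (x ^ 3 + x ^ 4 + x ^ 5) * D (x ^ 3) - (x + x\<^sup>2 + x ^ 3) / (1 - x) * F (x ^ 3)"])
    fix x :: real assume x: "x \<in> {-1/2<..0}"
    show "((\<lambda>x. H (u x)) has_field_derivative - ((t x)\<^sup>2 / (1 - x)\<^sup>2 * G (u x))) (at x within {-1/2<..0})"
      using DERIV_subset[OF cubic_rhs_deriv[OF x]] by (simp add: H_def G_def u_def t_def)
    show "((\<lambda>x. (1 - x) * F (x ^ 3)) has_field_derivative
            (1 - x) * (2/3 * x\<^sup>2 * D (x ^ 3)) - F (x ^ 3)) (at x within {-1/2<..0})"
      using DERIV_subset[OF cubic_lhs_deriv[OF bounds(4)[OF x]]] by (simp add: F_def D_def)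
    \<comment> \<open>The numerator is
      \<open>(1 - x)^3 - (1 + 2 x)^3 = - 9 x (1 + x + x^2)\<close>.\<close>
    have u_eq: "u x = - (9 * x * (1 - x ^ 3) / (1 - x) ^ 4)"
      unfolding u_def t_def using nz[OF x] by (simp add: power_divide divide_simps) algebra
    show "u x * (t x)\<^sup>2 * G (u x) / 9 = p x * - ((t x)\<^sup>2 / (1 - x)\<^sup>2 * G (u x))"
      unfolding u_eq p_def using nz[OF x] by (simp add: divide_simps)
    show "2/3 * (x ^ 3 + x ^ 4 + x ^ 5) * D (x ^ 3) - (x + x\<^sup>2 + x ^ 3) / (1 - x) * F (x ^ 3) =
            p x * ((1 - x) * (2/3 * x\<^sup>2 * D (x ^ 3)) - F (x ^ 3))"
      unfolding p_def using nz[OF x] by (simp add: divide_simps) algebra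
    show "H (u x) \<noteq> 0"
      using gauss_2F1_pos[of "1/3" "1/3" 1 "u x"] bounds(2)[OF x] by (simp add: H_def)
  next
    show "p x \<noteq> 0" if "x \<in> {-1/2<..0} - {0}" for x
    proof -
      have "\<bar>x ^ 3\<bar> < 1" using that by (intro bounds(4)) auto
      hence "x ^ 3 \<noteq> 1" by auto
      thus ?thesis using that by (simp add: p_def)
    qed
  qed (use x Y V DERIV_continuous_on[OF Y] DERIV_continuous_on[OF V] in
        \<open>simp_all add: p_def u_def t_def F_def H_def\<close>)
  thus ?thesis by (simp add: F_def H_def u_def t_def)
qed

subsection \<open>The value at -1/8\<close>

text \<open>Right-hand limits at \<open>x = -1/2\<close> of the cubic transformation and of its
  derivative. There \<open>1 - x\<close> is 3/2, which accounts for the factors 3/2 and 4/9.\<close>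

lemma gauss_2F1_minus_eighth_eq_1:
  "3/2 * gauss_2F1 (1/3) (2/3) 1 (-1/8 :: real) = gauss_2F1 (1/3) (1/3) 1 1" (is ?value)
  and gauss_2F1_minus_eighth_deriv_eq_1:
  "gauss_2F1 (1/3) (2/3) 1 (-1/8 :: real) - gauss_2F1 (4/3) (5/3) 2 (-1/8) / 4 =
     4/9 * gauss_2F1 (2/3) (2/3) 2 1" (is ?deriv)
proof -
  define F where "F = gauss_2F1 (1/3) (2/3) (1::real)"
  define D where "D = gauss_2F1 (4/3) (5/3) (2::real)"
  define t where "t = (\<lambda>x::real. (1 + 2 * x) / (1 - x))"
  \<comment> \<open>The interval is open at 0 too, so that an identity on it may be
    differentiated.\<close>
  have near: "eventually (\<lambda>x. x \<in> {-1/2<..<0}) (at_right (-1/2 :: real))"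
    by (intro eventually_at_right_real) auto
  have arg: "((\<lambda>x. 1 - t x ^ 3) \<longlongrightarrow> 1) (at_right (-1/2))"
    unfolding t_def by (auto intro!: tendsto_eq_intros)
  have limit_1: "((\<lambda>x. gauss_2F1 a b c (1 - t x ^ 3)) \<longlongrightarrow> gauss_2F1 a b c 1) (at_right (-1/2))"
    if "a > 0" "b > 0" "c > a + b" for a b c
  proof (rule continuous_on_tendsto_compose[OF continuous_on_gauss_2F1_unit_interval[OF that] arg])
    show "\<forall>\<^sub>F x in at_right (- 1 / 2). 1 - t x ^ 3 \<in> {0..1}"
      using near by eventually_elim (use cubic_arg_bounds(3) in \<open>force simp: t_def\<close>)
  qed simp
  have cube: "((\<lambda>x. x ^ 3) \<longlongrightarrow> -1/8) (at_right (-1/2 :: real))"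
    by (auto intro!: tendsto_eq_intros simp: power3_eq_cube)
  have F: "((\<lambda>x. F (x ^ 3)) \<longlongrightarrow> F (-1/8)) (at_right (-1/2))"
    unfolding F_def by (rule isCont_tendsto_compose[OF DERIV_isCont[OF has_field_derivative_gauss_2F1] cube]) auto
  have D: "((\<lambda>x. D (x ^ 3)) \<longlongrightarrow> D (-1/8)) (at_right (-1/2))"
    unfolding D_def by (rule isCont_tendsto_compose[OF DERIV_isCont[OF has_field_derivative_gauss_2F1] cube]) auto
  have eq: "(1 - x) * F (x ^ 3) = gauss_2F1 (1/3) (1/3) 1 (1 - t x ^ 3)" if "x \<in> {-1/2<..<0}" for x
    using cubic_transformation[of x] that by (simp add: F_def t_def)
  have "((\<lambda>x. (1 - x) * F (x ^ 3)) \<longlongrightarrow> (1 - (-1/2)) * F (-1/8)) (at_right (-1/2))"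
    by (intro tendsto_intros F)
  moreover have "((\<lambda>x. (1 - x) * F (x ^ 3)) \<longlongrightarrow> gauss_2F1 (1/3) (1/3) 1 1) (at_right (-1/2))"
    by (rule Lim_transform_eventually[OF limit_1])
       (use near in \<open>auto elim!: eventually_mono simp: eq\<close>)
  ultimately have "(1 - (-1/2)) * F (-1/8) = gauss_2F1 (1/3) (1/3) 1 1"
    by (rule tendsto_unique[rotated]) simp
  thus ?value by (simp add: F_def)
  have eq': "F (x ^ 3) - (1 - x) * (2/3 * x\<^sup>2 * D (x ^ 3)) = gauss_2F1 (2/3) (2/3) 2 (1 - t x ^ 3) / (1 - x)\<^sup>2"
    if x: "x \<in> {-1/2<..<0}" for x
  proof -
    have bounds: "t x > 0" "1 - t x ^ 3 \<in> {0..<1}" "\<bar>x ^ 3\<bar> < 1"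
      using cubic_arg_bounds[of x] x by (simp_all add: t_def)
    have "((\<lambda>x. gauss_2F1 (1/3) (1/3) 1 (1 - t x ^ 3)) has_field_derivative
            (1 - x) * (2/3 * x\<^sup>2 * D (x ^ 3)) - F (x ^ 3)) (at x)"
      using cubic_lhs_deriv[OF bounds(3)] unfolding F_def[symmetric] D_def[symmetric]
      by (rule has_field_derivative_transform_within_open[where S = "{-1/2<..<0}"]) (use x eq in auto)
    moreover have "((\<lambda>x. gauss_2F1 (1/3) (1/3) 1 (1 - t x ^ 3)) has_field_derivative
           - ((t x)\<^sup>2 / (1 - x)\<^sup>2 * gauss_2F1 (4/3) (4/3) 2 (1 - t x ^ 3))) (at x)"
      unfolding t_def using x by (intro cubic_rhs_deriv) auto
    ultimately have "(1 - x) * (2/3 * x\<^sup>2 * D (x ^ 3)) - F (x ^ 3) =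
        - ((t x)\<^sup>2 / (1 - x)\<^sup>2 * gauss_2F1 (4/3) (4/3) 2 (1 - t x ^ 3))"
      by (rule DERIV_unique)
    \<comment> \<open>The series with parameters \<open>4/3, 4/3; 2\<close> is outside the range
      \<open>c > a + b\<close> of Gauss's theorem. Euler's transformation has exponent
      \<open>2 - 8/3 = -2/3\<close>, so its prefactor \<open>t powr (-2)\<close> cancels
      \<open>t^2\<close> and leaves a series within that range.\<close>
    moreover have "(t x)\<^sup>2 * gauss_2F1 (4/3) (4/3) 2 (1 - t x ^ 3) = gauss_2F1 (2/3) (2/3) 2 (1 - t x ^ 3)"
    proof -
      have "(t x ^ 3) powr (-2/3) = t x powr (-2)"
        using bounds(1) by (simp add: powr_powr flip: powr_numeral)
      hence "t x powr (-2) * gauss_2F1 (2/3) (2/3) 2 (1 - t x ^ 3) = gauss_2F1 (4/3) (4/3) 2 (1 - t x ^ 3)"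
        using euler_transformation[of "4/3" "4/3" 2 "1 - t x ^ 3"] bounds(2) by simp
      thus ?thesis
        using bounds(1) by (simp add: powr_minus field_simps)
    qed
    ultimately show ?thesis by (simp add: algebra_simps)
  qed
  have "((\<lambda>x. F (x ^ 3) - (1 - x) * (2/3 * x\<^sup>2 * D (x ^ 3))) \<longlongrightarrow>
          F (-1/8) - (1 - (-1/2)) * (2/3 * (-1/2)\<^sup>2 * D (-1/8))) (at_right (-1/2))"
    by (intro tendsto_intros F D)
  moreover have "((\<lambda>x. F (x ^ 3) - (1 - x) * (2/3 * x\<^sup>2 * D (x ^ 3))) \<longlongrightarrow>
          gauss_2F1 (2/3) (2/3) 2 1 / (1 - (-1/2))\<^sup>2) (at_right (-1/2))"
  proof (rule Lim_transform_eventually)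
    show "((\<lambda>x. gauss_2F1 (2/3) (2/3) 2 (1 - t x ^ 3) / (1 - x)\<^sup>2) \<longlongrightarrow>
            gauss_2F1 (2/3) (2/3) 2 1 / (1 - (-1/2))\<^sup>2) (at_right (-1/2))"
      by (intro tendsto_intros limit_1) auto
  qed (rule eventually_mono[OF near], simp only: eq')
  ultimately have "F (-1/8) - (1 - (-1/2)) * (2/3 * (-1/2)\<^sup>2 * D (-1/8)) =
                   gauss_2F1 (2/3) (2/3) 2 1 / (1 - (-1/2))\<^sup>2"
    by (rule tendsto_unique[rotated]) simp
  thus ?deriv by (simp add: F_def D_def power2_eq_square)
qed

text \<open>Euler's reflection formula at 1/3, taken over the complex numbers and pulled back to the
  reals.\<close>

lemma Gamma_third_mult_Gamma_two_thirds: "Gamma (1/3) * Gamma (2/3) = 2 * pi / sqrt 3"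
proof -
  have "complex_of_real (Gamma (1/3) * Gamma (2/3)) =
          Gamma (complex_of_real (1/3)) * Gamma (1 - complex_of_real (1/3))"
    by (simp flip: Gamma_complex_of_real)
  also have "\<dots> = complex_of_real (pi / sin (pi / 3))"
    unfolding Gamma_reflection_complex by (simp flip: sin_of_real)
  finally show ?thesis
    unfolding of_real_eq_iff by (simp add: sin_60)
qed

text \<open>The left-hand side factors as \<open>F (F - D / 4)\<close>, and Gauss's theorem
  evaluates each factor. One power of each Gamma value survives in the denominator.\<close>

lemma gauss_2F1_minus_eighth_identity:
  "(gauss_2F1 (1/3) (2/3) 1 (-1/8 :: real))\<^sup>2
     - 1/4 * gauss_2F1 (1/3) (2/3) 1 (-1/8) * gauss_2F1 (4/3) (5/3) 2 (-1/8) = 4 / (sqrt 3 * pi)"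
proof -
  define F D where "F = gauss_2F1 (1/3) (2/3) (1::real) (-1/8)"
    and "D = gauss_2F1 (4/3) (5/3) (2::real) (-1/8)"
  have pos: "Gamma (1/3 :: real) > 0" "Gamma (2/3 :: real) > 0"
    by (simp_all add: Gamma_real_pos)
  have G43: "Gamma (4/3 :: real) = Gamma (1/3) / 3"
    using Gamma_plus1[of "1/3 :: real"] by (force dest: nonpos_Ints_nonpos)
  have F: "3/2 * F = Gamma (1/3) / (Gamma (2/3))\<^sup>2"
    unfolding F_def gauss_2F1_minus_eighth_eq_1 using gauss_summation[of "1/3" "1/3" 1]
    by (simp add: power2_eq_square)
  have D: "F - D / 4 = 4/9 * (9 * Gamma (2/3) / (Gamma (1/3))\<^sup>2)"
    unfolding F_def D_def gauss_2F1_minus_eighth_deriv_eq_1 using gauss_summation[of "2/3" "2/3" 2]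
    by (simp add: power2_eq_square G43 Gamma_numeral)
  have "F\<^sup>2 - 1/4 * F * D = 2/3 * (3/2 * F) * (F - D / 4)"
    by (simp add: power2_eq_square algebra_simps)
  also have "\<dots> = 8/3 / (Gamma (1/3) * Gamma (2/3))"
    unfolding F D using pos by (simp add: power2_eq_square)
  also have "\<dots> = 4 / (sqrt 3 * pi)"
    unfolding Gamma_third_mult_Gamma_two_thirds
    using real_sqrt_mult_self[of 3] by (simp add: field_simps)
  finally show ?thesis by (simp add: F_def D_def)
qed

section \<open>The series for 1/pi\<close>

lemma binomial_mult_eq_hyp_coeff:
  "real ((2 * k) choose k) * real ((3 * k) choose k) = 27 ^ k * hyp_coeff (1/3) (2/3) 1 k"
proof -
  have "real ((2 * k) choose k) * real ((3 * k) choose k) = fact (3 * k) / fact k ^ 3"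
    by (simp add: binomial_fact power3_eq_cube)
  also have "\<dots> = 27 ^ k * hyp_coeff (1/3) (2/3) 1 k"
  proof (induction k)
    case (Suc k)
    have "3 * Suc k = Suc (Suc (Suc (3 * k)))" by simp
    hence "fact (3 * Suc k) = (3 * real k + 1) * (3 * real k + 2) * (3 * real k + 3) * fact (3 * k)"
      by (simp only: fact_Suc) (simp add: algebra_simps)
    moreover have "fact (Suc k) ^ 3 = (real k + 1) ^ 3 * fact k ^ 3"
      by (simp add: power_mult_distrib add.commute)
    ultimately have "fact (3 * Suc k) / fact (Suc k) ^ 3 = fact (3 * k) / fact k ^ 3 *
            ((3 * real k + 1) * (3 * real k + 2) * (3 * real k + 3) / (real k + 1) ^ 3)"
      by (simp only:) (simp only: times_divide_times_eq mult_ac)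
    \<comment> \<open>The right-hand side is 27 times the ratio of consecutive coefficients in
      \<open>hyp_coeff_Suc\<close>.\<close>
    also have "(3 * real k + 1) * (3 * real k + 2) * (3 * real k + 3) / (real k + 1) ^ 3 =
                 27 * ((1/3 + real k) * (2/3 + real k) / ((real k + 1) * (1 + real k)))"
      by (simp add: divide_simps power3_eq_cube) (simp add: algebra_simps)
    finally show ?case by (simp only: Suc.IH hyp_coeff_Suc) simp
  qed simp
  finally show ?thesis .
qed

text \<open>By the symmetry between \<open>k\<close> and \<open>n - k\<close>, the weight
  \<open>n\<close> on a self-convolution counts as twice the weight \<open>k\<close>. This leaves
  Cauchy products of absolutely convergent series.\<close>

lemma sums_linear_times_convolution:
  fixes f :: "nat \<Rightarrow> 'a :: {real_normed_field, banach}"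
  assumes "summable (\<lambda>n. norm (f n))" "summable (\<lambda>n. norm (of_nat n * f n))"
  shows "(\<lambda>n. (p * of_nat n + q) * (\<Sum>k\<le>n. f k * f (n - k))) sums
           (2 * p * (\<Sum>n. of_nat n * f n) * (\<Sum>n. f n) + q * (\<Sum>n. f n)\<^sup>2)"
proof -
  have "of_nat n * (\<Sum>k\<le>n. f k * f (n - k)) = 2 * (\<Sum>k\<le>n. of_nat k * f k * f (n - k))" for n
  proof -
    have "of_nat n * (\<Sum>k\<le>n. f k * f (n - k)) =
            (\<Sum>k\<le>n. of_nat k * f k * f (n - k)) + (\<Sum>k\<le>n. of_nat (n - k) * f (n - k) * f k)"
      by (auto simp: sum_distrib_left of_nat_diff algebra_simps simp flip: sum.distrib intro!: sum.cong)
    also have "(\<Sum>k\<le>n. of_nat (n - k) * f (n - k) * f k) = (\<Sum>k\<le>n. of_nat k * f k * f (n - k))"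
      by (rule sum.reindex_bij_witness[of _ "\<lambda>k. n - k" "\<lambda>k. n - k"]) auto
    finally show ?thesis by simp
  qed
  hence "(p * of_nat n + q) * (\<Sum>k\<le>n. f k * f (n - k)) =
           2 * p * (\<Sum>k\<le>n. of_nat k * f k * f (n - k)) + q * (\<Sum>k\<le>n. f k * f (n - k))" for n
    by (simp add: distrib_right mult.assoc)
  moreover have "(\<lambda>n. 2 * p * (\<Sum>k\<le>n. of_nat k * f k * f (n - k)) + q * (\<Sum>k\<le>n. f k * f (n - k))) sums
      (2 * p * ((\<Sum>n. of_nat n * f n) * (\<Sum>n. f n)) + q * ((\<Sum>n. f n) * (\<Sum>n. f n)))"
    by (intro sums_add sums_mult Cauchy_product_sums assms)
  ultimately show ?thesis by (simp add: power2_eq_square mult.assoc)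
qed

theorem theorem1p2:
  shows "((\<lambda>n. (9 * real n + 2) / (-216) ^ n *
            (\<Sum>k=0..n. real ((2 * k) choose k) * real ((3 * k) choose k) *
               real ((2 * (n - k)) choose (n - k)) * real ((3 * (n - k)) choose (n - k))))
          sums (8 / (sqrt 3 * pi))) \<and>
         (gauss_2F1 (1/3) (2/3) 1 (-1/8))\<^sup>2
           - 1/4 * gauss_2F1 (1/3) (2/3) 1 (-1/8) * gauss_2F1 (4/3) (5/3) 2 (-1/8)
         = 4 / (sqrt 3 * pi)"
proof
  define F D where "F = gauss_2F1 (1/3) (2/3) (1::real) (-1/8)"
    and "D = gauss_2F1 (4/3) (5/3) (2::real) (-1/8)"
  define h where "h = hyp_coeff (1/3) (2/3) 1"
  \<comment> \<open>The argument is forced by \<open>-216 = 27 * (-8)\<close>, the powers of 27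
    coming from the binomial products.\<close>
  define f where "f n = h n * (-1/8) ^ n" for n
  have h: "h n \<ge> 0" for n
    unfolding h_def by (intro hyp_coeff_nonneg) auto
  have f: "summable (\<lambda>n. norm (f n))" "(\<Sum>n. f n) = F"
    using gauss_2F1_sums[of 1 "1/8" "1/3" "2/3"] gauss_2F1_sums[of 1 "-1/8" "1/3" "2/3"] h
    by (simp_all add: f_def F_def abs_mult power_abs sums_iff flip: h_def)
  \<comment> \<open>The value is \<open>(1/3) (2/3) (-1/8) D\<close>. As \<open>h\<close> is
    nonnegative, absolute summability is convergence at 1/8.\<close>
  have nf: "summable (\<lambda>n. norm (real n * f n))" "(\<Sum>n. real n * f n) = - D / 36"
    using sums_of_nat_times_hyp_coeff[of 1 "1/8" "1/3" "2/3"]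
      sums_of_nat_times_hyp_coeff[of 1 "-1/8" "1/3" "2/3"] h
    by (simp_all add: f_def D_def abs_mult power_abs sums_iff mult.assoc flip: h_def)
  have term_eq: "(9 * real n + 2) / (-216) ^ n *
            (\<Sum>k=0..n. real ((2 * k) choose k) * real ((3 * k) choose k) *
               real ((2 * (n - k)) choose (n - k)) * real ((3 * (n - k)) choose (n - k))) =
          (9 * real n + 2) * (\<Sum>k\<le>n. f k * f (n - k))" for n
  proof -
    have "real ((2 * k) choose k) * real ((3 * k) choose k) *
            real ((2 * (n - k)) choose (n - k)) * real ((3 * (n - k)) choose (n - k)) =
          (-216) ^ n * (f k * f (n - k))" if "k \<le> n" for k
    proof -
      have "real ((2 * k) choose k) * real ((3 * k) choose k) *
              (real ((2 * (n - k)) choose (n - k)) * real ((3 * (n - k)) choose (n - k))) =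
            27 ^ (k + (n - k)) * (h k * h (n - k))"
        unfolding binomial_mult_eq_hyp_coeff power_add h_def by (simp add: mult_ac)
      also have "\<dots> = (-216) ^ n * ((-1/8) ^ (k + (n - k)) * (h k * h (n - k)))"
        using that by (simp flip: power_mult_distrib mult.assoc)
      also have "\<dots> = (-216) ^ n * (f k * f (n - k))"
        unfolding f_def power_add by (simp add: mult_ac)
      finally show ?thesis by (simp add: mult.assoc)
    qed
    hence "(\<Sum>k=0..n. real ((2 * k) choose k) * real ((3 * k) choose k) *
            real ((2 * (n - k)) choose (n - k)) * real ((3 * (n - k)) choose (n - k))) =
          (-216) ^ n * (\<Sum>k\<le>n. f k * f (n - k))"
      by (simp add: sum_distrib_left atLeast0AtMost)
    thus ?thesis by simp
  qed
  show identity: "(gauss_2F1 (1/3) (2/3) 1 (-1/8))\<^sup>2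
           - 1/4 * gauss_2F1 (1/3) (2/3) 1 (-1/8) * gauss_2F1 (4/3) (5/3) 2 (-1/8)
         = 4 / (sqrt 3 * pi)"
    by (rule gauss_2F1_minus_eighth_identity)
  have "(\<lambda>n. (9 * real n + 2) * (\<Sum>k\<le>n. f k * f (n - k))) sums (2 * 9 * (- D / 36) * F + 2 * F\<^sup>2)"
    using sums_linear_times_convolution[OF f(1) nf(1), of 9 2] unfolding f(2) nf(2) .
  \<comment> \<open>The coefficients 9 and 2 produce exactly twice the combination in the second
    identity.\<close>
  also have "2 * 9 * (- D / 36) * F + 2 * F\<^sup>2 = 2 * (F\<^sup>2 - 1/4 * F * D)"
    by (simp add: algebra_simps)
  also have "\<dots> = 8 / (sqrt 3 * pi)"
    unfolding F_def D_def identity by simp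
  finally show "(\<lambda>n. (9 * real n + 2) / (-216) ^ n *
            (\<Sum>k=0..n. real ((2 * k) choose k) * real ((3 * k) choose k) *
               real ((2 * (n - k)) choose (n - k)) * real ((3 * (n - k)) choose (n - k))))
          sums (8 / (sqrt 3 * pi))"
    unfolding term_eq .
qed

end
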